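(* Let $\{x_{i,t},s_{i,t}\}$ be a feasible solution of $(\mathrm{LP}')$ for an instance of correlated stochastic knapsack with no cancellation. Then there exists an adaptive policy (not necessarily computable in polynomial time) that, for every job $i\in[n]$ and time $t\in[B]$, starts job $i$ at the beginning of time $t$ with probability exactly $\frac{x_{i,t}}{2}$; hence its expected reward is half the objective value $\sum_{i}\sum_t \mathrm{ER}_{i,t}x_{i,t}$. Consequently the projection gap of $(\mathrm{LP}')$ is at most $2$: for every instance, $\mathrm{OPT}_{\mathrm{LP}'}\le 2\cdot(\text{maximum expected reward of any policy})$.
   Context: Correlated stochastic knapsack with no cancellation: there are $n$ jobs $i\in[n]$ and a time budget $B$ (a positive integer, time steps $1,\dots,B$). Job $i$ has a random processing time $S_i$, a positive integer, and a random nonnegative reward $R_i$ whose joint distribution with $S_i$ is known (rewards may be correlated with processing times; jobs are independent of each other). Whenever no job is in progress at the beginning of a time step, the controller may start one not-yet-started job or idle; a job started at the beginning of time $t$ runs without interruption (it cannot be cancelled) for $S_i$ steps, its realized size and reward being revealed only as it runs, and its reward is collected iff it completes by the end of time $B$, i.e. $t+S_i-1\le B$. Goal: maximize expected collected reward. Define $\mathrm{ER}_{i,t}=\sum_{t'=t+1}^{B+1}\mathbb{E}[R_i\mid S_i=t'-t]\Pr[S_i=t'-t]$. $(\mathrm{LP}')$: variables $x_{i,t},s_{i,t}$ ($i\in[n],t\in[B]$); maximize $\sum_i\sum_{t=1}^B\mathrm{ER}_{i,t}x_{i,t}$ subject to $\sum_{i=1}^n\sum_{t'=1}^t x_{i,t'}\Pr[S_i>t-t']\le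 1$ for all $t\in[B]$; $0\le x_{i,t}\le s_{i,t}$; $s_{i,1}=1$; $s_{i,t}=s_{i,t-1}-x_{i,t-1}$ for $t>1$. $\mathrm{OPT}_{\mathrm{LP}'}$ denotes its optimum. *)

theory Defs
  imports "HOL-Probability.Probability"
begin

text \<open>Jobs are numbered \<open>1..n\<close> and time steps \<open>1..B\<close>. \<open>S i\<close> and \<open>R i\<close> are the processing time and
  the reward of job \<open>i\<close>; within one job they may be arbitrarily correlated. Measurability of the
  pairs is part of \<open>indep_vars\<close>.\<close>

locale correlated_knapsack = prob_space M
  for M :: "'w measure" +
  fixes n :: nat and B :: nat
    and S :: "nat \<Rightarrow> 'w \<Rightarrow> nat" and R :: "nat \<Rightarrow> 'w \<Rightarrow> real"
  assumes budget_pos: "0 < B"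
    and size_pos: "\<And>i \<omega>. i \<in> {1..n} \<Longrightarrow> \<omega> \<in> space M \<Longrightarrow> 0 < S i \<omega>"
    and reward_nonneg: "\<And>i \<omega>. i \<in> {1..n} \<Longrightarrow> \<omega> \<in> space M \<Longrightarrow> 0 \<le> R i \<omega>"
    and jobs_indep: "indep_vars (\<lambda>_. count_space UNIV \<Otimes>\<^sub>M borel) (\<lambda>i \<omega>. (S i \<omega>, R i \<omega>)) {1..n}"

text \<open>A history lists the jobs started so far as tuples (job, start time, size, reward).
  A randomized adaptive policy maps the current time and the history to a distribution over
  actions: \<open>Some i\<close> starts job \<open>i\<close>, \<open>None\<close> idles. It is consulted only when no job is in progress,
  so every size and reward in the history it receives has already been revealed.\<close>

type_synonym history = "(nat \<times> nat \<times> nat \<times> real) list"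

type_synonym policy = "nat \<Rightarrow> history \<Rightarrow> nat option pmf"

definition in_progress :: "history \<Rightarrow> nat \<Rightarrow> bool" where
  "in_progress h t \<longleftrightarrow> (\<exists>(i, u, s, r) \<in> set h. t < u + s)"

definition starts_at :: "history \<Rightarrow> nat \<Rightarrow> nat \<Rightarrow> bool" where
  "starts_at h i t \<longleftrightarrow> (\<exists>s r. (i, t, s, r) \<in> set h)"

text \<open>The second condition is measurable dependence on the revealed outcomes: for each fixed
  sequence \<open>js\<close> of (job, start time) pairs, the action probabilities are Borel functions of
  the outcomes \<open>\<zeta> i = (size, reward)\<close> of these jobs.\<close>

definition admissible_policy :: "nat \<Rightarrow> nat \<Rightarrow> policy \<Rightarrow> bool" where
  "admissible_policy n B \<pi> \<longleftrightarrow>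
     (\<forall>t\<in>{1..B}. \<forall>h. set_pmf (\<pi> t h) \<subseteq> insert None (Some ` ({1..n} - fst ` set h))) \<and>
     (\<forall>t\<in>{1..B}. \<forall>js a. fst ` set js \<subseteq> {1..n} \<longrightarrow>
        (\<lambda>\<zeta>. pmf (\<pi> t (map (\<lambda>(i, u). (i, u, \<zeta> i)) js)) a)
          \<in> borel_measurable (\<Pi>\<^sub>M i\<in>{1..n}. count_space UNIV \<Otimes>\<^sub>M borel))"

text \<open>Given the outcomes \<open>\<zeta>\<close> of all jobs, \<open>run \<pi> \<zeta> t\<close> is the law, over the internal randomness of
  the policy, of the history after the decision at the beginning of time \<open>t\<close>.\<close>

definition step :: "policy \<Rightarrow> (nat \<Rightarrow> nat \<times> real) \<Rightarrow> nat \<Rightarrow> history \<Rightarrow> history pmf" where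
  "step \<pi> \<zeta> t h =
     (if in_progress h t then return_pmf h
      else map_pmf (\<lambda>a. case a of None \<Rightarrow> h | Some i \<Rightarrow> h @ [(i, t, \<zeta> i)]) (\<pi> t h))"

primrec run :: "policy \<Rightarrow> (nat \<Rightarrow> nat \<times> real) \<Rightarrow> nat \<Rightarrow> history pmf" where
  "run \<pi> \<zeta> 0 = return_pmf []"
| "run \<pi> \<zeta> (Suc t) = bind_pmf (run \<pi> \<zeta> t) (step \<pi> \<zeta> (Suc t))"

text \<open>Expectation of a nonnegative functional of the final history, over the outcomes of the jobs
  and the (independent) internal randomness of the policy.\<close>

definition policy_expectation ::
  "'w measure \<Rightarrow> nat \<Rightarrow> (nat \<Rightarrow> 'w \<Rightarrow> nat) \<Rightarrow> (nat \<Rightarrow> 'w \<Rightarrow> real) \<Rightarrow> policy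
     \<Rightarrow> (history \<Rightarrow> ennreal) \<Rightarrow> ennreal" where
  "policy_expectation M B S R \<pi> f =
     (\<integral>\<^sup>+ \<omega>. (\<integral>\<^sup>+ h. f h \<partial>measure_pmf (run \<pi> (\<lambda>i. (S i \<omega>, R i \<omega>)) B)) \<partial>M)"

definition start_prob ::
  "'w measure \<Rightarrow> nat \<Rightarrow> (nat \<Rightarrow> 'w \<Rightarrow> nat) \<Rightarrow> (nat \<Rightarrow> 'w \<Rightarrow> real) \<Rightarrow> policy
     \<Rightarrow> nat \<Rightarrow> nat \<Rightarrow> ennreal" where
  "start_prob M B S R \<pi> i t = policy_expectation M B S R \<pi> (indicator {h. starts_at h i t})"

definition collected_reward :: "nat \<Rightarrow> history \<Rightarrow> ennreal" where
  "collected_reward B h = (\<Sum>(i, t, s, r)\<leftarrow>h. if t + s - 1 \<le> B then ennreal r else 0)"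

definition expected_reward ::
  "'w measure \<Rightarrow> nat \<Rightarrow> (nat \<Rightarrow> 'w \<Rightarrow> nat) \<Rightarrow> (nat \<Rightarrow> 'w \<Rightarrow> real) \<Rightarrow> policy \<Rightarrow> ennreal" where
  "expected_reward M B S R \<pi> = policy_expectation M B S R \<pi> (collected_reward B)"

definition max_expected_reward ::
  "'w measure \<Rightarrow> nat \<Rightarrow> nat \<Rightarrow> (nat \<Rightarrow> 'w \<Rightarrow> nat) \<Rightarrow> (nat \<Rightarrow> 'w \<Rightarrow> real) \<Rightarrow> ennreal" where
  "max_expected_reward M n B S R = (SUP \<pi>\<in>{\<pi>. admissible_policy n B \<pi>}. expected_reward M B S R \<pi>)"

text \<open>The elementary conditional expectation given the event \<open>S i = k\<close>; it is \<open>0\<close> if this event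
  is null, in which case it enters the linear program with weight \<open>0\<close>.\<close>

definition cond_reward ::
  "'w measure \<Rightarrow> (nat \<Rightarrow> 'w \<Rightarrow> nat) \<Rightarrow> (nat \<Rightarrow> 'w \<Rightarrow> real) \<Rightarrow> nat \<Rightarrow> nat \<Rightarrow> ennreal" where
  "cond_reward M S R i k =
     (\<integral>\<^sup>+ \<omega>. ennreal (R i \<omega>) * indicator {\<omega>. S i \<omega> = k} \<omega> \<partial>M) / emeasure M {\<omega> \<in> space M. S i \<omega> = k}"

definition ER ::
  "'w measure \<Rightarrow> nat \<Rightarrow> (nat \<Rightarrow> 'w \<Rightarrow> nat) \<Rightarrow> (nat \<Rightarrow> 'w \<Rightarrow> real) \<Rightarrow> nat \<Rightarrow> nat \<Rightarrow> ennreal" where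
  "ER M B S R i t =
     (\<Sum>t'=t+1..B+1. cond_reward M S R i (t' - t) * emeasure M {\<omega> \<in> space M. S i \<omega> = t' - t})"

definition lp_feasible ::
  "'w measure \<Rightarrow> nat \<Rightarrow> nat \<Rightarrow> (nat \<Rightarrow> 'w \<Rightarrow> nat)
     \<Rightarrow> (nat \<Rightarrow> nat \<Rightarrow> real) \<Rightarrow> (nat \<Rightarrow> nat \<Rightarrow> real) \<Rightarrow> bool" where
  "lp_feasible M n B S x s \<longleftrightarrow>
     (\<forall>t\<in>{1..B}. (\<Sum>i=1..n. \<Sum>t'=1..t. x i t' * measure M {\<omega> \<in> space M. S i \<omega> > t - t'}) \<le> 1) \<and>
     (\<forall>i\<in>{1..n}. \<forall>t\<in>{1..B}. 0 \<le> x i t \<and> x i t \<le> s i t) \<and>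
     (\<forall>i\<in>{1..n}. s i 1 = 1) \<and>
     (\<forall>i\<in>{1..n}. \<forall>t\<in>{1..B}. t > 1 \<longrightarrow> s i t = s i (t - 1) - x i (t - 1))"

definition lp_objective ::
  "'w measure \<Rightarrow> nat \<Rightarrow> nat \<Rightarrow> (nat \<Rightarrow> 'w \<Rightarrow> nat) \<Rightarrow> (nat \<Rightarrow> 'w \<Rightarrow> real)
     \<Rightarrow> (nat \<Rightarrow> nat \<Rightarrow> real) \<Rightarrow> ennreal" where
  "lp_objective M n B S R x = (\<Sum>i=1..n. \<Sum>t=1..B. ER M B S R i t * ennreal (x i t))"

definition lp_opt ::
  "'w measure \<Rightarrow> nat \<Rightarrow> nat \<Rightarrow> (nat \<Rightarrow> 'w \<Rightarrow> nat) \<Rightarrow> (nat \<Rightarrow> 'w \<Rightarrow> real) \<Rightarrow> ennreal" where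
  "lp_opt M n B S R = (SUP (x, s)\<in>{(x, s). lp_feasible M n B S x s}. lp_objective M n B S R x)"

end

theory Submission
  imports Defs
begin

text \<open>The policy decides on the basis of the time and the set of started jobs only, and it is built
  one time step at a time. Suppose that each job \<open>j\<close> has been started at each time \<open>u < t\<close> with
  probability \<open>x j u / 2\<close>. Since the start of a job is independent of its own size, the machine is
  busy at time \<open>t\<close> with probability at most
  \<open>\<Sum>j. \<Sum>u<t. x j u / 2 * P(S j > t - u) \<le> (1 - X) / 2\<close>, where \<open>X = \<Sum>j. x j t\<close>, and job \<open>i\<close> has been
  started with probability \<open>(1 - s i t) / 2 \<le> 1 / 2\<close>. By the union bound, the machine is free and
  \<open>i\<close> is available with probability at least \<open>X / 2\<close>. As this holds for every \<open>i\<close> and \<open>X / 2\<close> is the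
  total demand at time \<open>t\<close>, serving the jobs one after another never runs out of probability mass.\<close>

section \<open>Serving demands from limited supplies\<close>

text \<open>Each demand could alone draw on supplies worth the total demand, so whatever the others
  take still leaves it enough. Hence the demands can be met one after another, in any order;
  \<open>Q A i\<close> says that supply \<open>A\<close> may serve \<open>i\<close>.\<close>

lemma greedy_transport:
  fixes p :: "'a \<Rightarrow> real" and d :: "'b \<Rightarrow> real"
  assumes "finite J" "finite \<Omega>" "\<And>A. A \<in> \<Omega> \<Longrightarrow> 0 \<le> p A" "\<And>i. i \<in> J \<Longrightarrow> 0 \<le> d i"
    and "\<And>i. i \<in> J \<Longrightarrow> sum d J \<le> (\<Sum>A\<in>{A\<in>\<Omega>. Q A i}. p A)"
  shows "\<exists>y. (\<forall>A\<in>\<Omega>. \<forall>i\<in>J. 0 \<le> y A i \<and> (\<not> Q A i \<longrightarrow> y A i = 0)) \<and>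
             (\<forall>A\<in>\<Omega>. (\<Sum>i\<in>J. y A i) \<le> p A) \<and> (\<forall>i\<in>J. (\<Sum>A\<in>\<Omega>. y A i) = d i)"
  using assms
proof (induction J rule: finite_induct)
  case empty
  then show ?case by simp
next
  case (insert k J)
  have sum_ins: "sum d (insert k J) = d k + sum d J"
    using insert.hyps by simp
  have dk: "0 \<le> d k" using insert.prems by simp
  have "\<exists>y. (\<forall>A\<in>\<Omega>. \<forall>i\<in>J. 0 \<le> y A i \<and> (\<not> Q A i \<longrightarrow> y A i = 0)) \<and>
             (\<forall>A\<in>\<Omega>. (\<Sum>i\<in>J. y A i) \<le> p A) \<and> (\<forall>i\<in>J. (\<Sum>A\<in>\<Omega>. y A i) = d i)"
  proof (rule insert.IH)
    fix i assume "i \<in> J"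
    then show "sum d J \<le> (\<Sum>A\<in>{A\<in>\<Omega>. Q A i}. p A)"
      using insert.prems(4)[of i] sum_ins dk by simp
  qed (use insert.prems in auto)
  then obtain y where y: "\<And>A i. A \<in> \<Omega> \<Longrightarrow> i \<in> J \<Longrightarrow> 0 \<le> y A i"
    "\<And>A i. A \<in> \<Omega> \<Longrightarrow> i \<in> J \<Longrightarrow> \<not> Q A i \<Longrightarrow> y A i = 0"
    "\<And>A. A \<in> \<Omega> \<Longrightarrow> (\<Sum>i\<in>J. y A i) \<le> p A" "\<And>i. i \<in> J \<Longrightarrow> (\<Sum>A\<in>\<Omega>. y A i) = d i"
    by blast
  \<comment> \<open>\<open>r\<close> is what remains of each supply after \<open>J\<close> is
    served, and \<open>D\<close> is the part of it open to \<open>k\<close>.\<close>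
  define r where "r A = p A - (\<Sum>i\<in>J. y A i)" for A
  define D where "D = (\<Sum>A\<in>{A\<in>\<Omega>. Q A k}. r A)"
  have r0: "0 \<le> r A" if "A \<in> \<Omega>" for A using y(3)[OF that] by (simp add: r_def)
  \<comment> \<open>In the worst case all of \<open>J\<close> was served from supplies open to
    \<open>k\<close>; that removes at most \<open>sum d J\<close> from them and leaves at least
    \<open>d k\<close>.\<close>
  have "(\<Sum>A\<in>{A\<in>\<Omega>. Q A k}. \<Sum>i\<in>J. y A i) \<le> (\<Sum>A\<in>\<Omega>. \<Sum>i\<in>J. y A i)"
    using insert.prems y by (intro sum_mono2) (auto intro: sum_nonneg)
  also have "\<dots> = sum d J" using y(4) by (subst sum.swap) simp
  finally have D: "d k \<le> D"
    using insert.prems(4)[of k] sum_ins by (simp add: D_def r_def sum_subtractf)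
  \<comment> \<open>\<open>k\<close> takes the same fraction \<open>c\<close> of every remainder
    open to it. If \<open>D = 0\<close>, then \<open>d k = 0\<close> and division by zero gives
    \<open>c = 0\<close>, so \<open>c * D = d k\<close> holds in this case too.\<close>
  define c where "c = d k / D"
  have c: "0 \<le> c" "c \<le> 1" "c * D = d k"
    using D dk by (auto simp: c_def divide_le_eq_1)
  define y' where "y' A i = (if i = k then (if Q A k then c * r A else 0) else y A i)" for A i
  have y'J: "(\<Sum>i\<in>J. y' A i) = (\<Sum>i\<in>J. y A i)" for A
    using insert.hyps by (intro sum.cong) (auto simp: y'_def)
  have "(\<Sum>i\<in>insert k J. y' A i) \<le> p A" if A: "A \<in> \<Omega>" for A
  proof -
    have "y' A k \<le> r A"
      using mult_right_mono[OF c(2) r0[OF A]] r0[OF A] by (auto simp: y'_def)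
    then show ?thesis using insert.hyps y'J[of A] by (simp add: r_def)
  qed
  moreover have "(\<Sum>A\<in>\<Omega>. y' A k) = d k"
  proof -
    have "(\<Sum>A\<in>\<Omega>. y' A k) = (\<Sum>A\<in>{A\<in>\<Omega>. Q A k}. c * r A)"
      using insert.prems by (simp add: y'_def sum.inter_filter)
    also have "\<dots> = d k" using c by (simp add: D_def sum_distrib_left)
    finally show ?thesis .
  qed
  moreover have "(\<Sum>A\<in>\<Omega>. y' A i) = d i" if "i \<in> J" for i
  proof -
    have "i \<noteq> k" using that insert.hyps by auto
    then show ?thesis using y(4)[OF that] by (simp add: y'_def)
  qed
  moreover have "0 \<le> y' A i \<and> (\<not> Q A i \<longrightarrow> y' A i = 0)" if "A \<in> \<Omega>" "i \<in> insert k J" for A i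
    using that y(1,2)[of A i] r0[of A] c(1) by (cases "i = k") (simp_all add: y'_def)
  ultimately show ?case by (intro exI[of _ y']) simp
qed

lemma pmf_option_with_weights:
  fixes c :: "'a \<Rightarrow> real"
  assumes "finite J" "\<And>i. i \<in> J \<Longrightarrow> 0 \<le> c i" "sum c J \<le> 1"
  obtains q :: "'a option pmf" where "\<And>i. i \<in> J \<Longrightarrow> pmf q (Some i) = c i"
    "set_pmf q \<subseteq> insert None (Some ` {i\<in>J. c i \<noteq> 0})"
proof
  define w where "w a = (case a of None \<Rightarrow> 1 - sum c J | Some i \<Rightarrow> if i \<in> J then c i else 0)" for a
  have w0: "0 \<le> w a" for a
    using assms by (auto simp: w_def split: option.split)
  have "(\<integral>\<^sup>+ a. ennreal (w a) \<partial>count_space UNIV) = (\<Sum>a\<in>insert None (Some ` J). ennreal (w a))"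
    using assms by (intro nn_integral_count_space') (auto simp: w_def split: option.split)
  also have "\<dots> = ennreal (sum w (insert None (Some ` J)))"
    using w0 by (simp del: sum.insert)
  also have "sum w (insert None (Some ` J)) = 1"
    using assms by (subst sum.insert) (auto simp: w_def sum.reindex)
  finally have w1: "(\<integral>\<^sup>+ a. ennreal (w a) \<partial>count_space UNIV) = 1" by simp
  show "pmf (embed_pmf w) (Some i) = c i" if "i \<in> J" for i
    using that by (simp add: pmf_embed_pmf[OF w0 w1] w_def)
  show "set_pmf (embed_pmf w) \<subseteq> insert None (Some ` {i\<in>J. c i \<noteq> 0})"
  proof
    fix a assume "a \<in> set_pmf (embed_pmf w)"
    then show "a \<in> insert None (Some ` {i\<in>J. c i \<noteq> 0})"
      by (cases a) (auto simp: set_embed_pmf[OF w0 w1] w_def split: if_splits)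
  qed
qed

text \<open>Here \<open>p A\<close> stands for the probability that the machine is free with started
  set \<open>A\<close>. The transported mass divided by \<open>p A\<close> is the conditional
  probability of choosing \<open>i\<close>, given that situation.\<close>

lemma greedy_assignment:
  fixes p :: "'a set \<Rightarrow> real" and d :: "'a \<Rightarrow> real"
  assumes J: "finite J" and p: "\<And>A. A \<subseteq> J \<Longrightarrow> 0 \<le> p A" and d: "\<And>i. i \<in> J \<Longrightarrow> 0 \<le> d i"
    and cap: "\<And>i. i \<in> J \<Longrightarrow> sum d J \<le> (\<Sum>A\<in>{A\<in>Pow J. i \<notin> A}. p A)"
  obtains q :: "'a set \<Rightarrow> 'a option pmf"
  where "\<And>A. set_pmf (q A) \<subseteq> insert None (Some ` (J - A))"
    "\<And>i. i \<in> J \<Longrightarrow> (\<Sum>A\<in>Pow J. p A * pmf (q A) (Some i)) = d i"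
proof -
  obtain y where "\<forall>A\<in>Pow J. \<forall>i\<in>J. 0 \<le> y A i \<and> (\<not> i \<notin> A \<longrightarrow> y A i = 0)"
    "\<forall>A\<in>Pow J. (\<Sum>i\<in>J. y A i) \<le> p A" "\<forall>i\<in>J. (\<Sum>A\<in>Pow J. y A i) = d i"
    using greedy_transport[of J "Pow J" p d "\<lambda>A i. i \<notin> A"] assms by auto
  then have y: "\<And>A i. A \<subseteq> J \<Longrightarrow> i \<in> J \<Longrightarrow> 0 \<le> y A i"
    "\<And>A i. A \<subseteq> J \<Longrightarrow> i \<in> J \<Longrightarrow> i \<in> A \<Longrightarrow> y A i = 0"
    "\<And>A. A \<subseteq> J \<Longrightarrow> (\<Sum>i\<in>J. y A i) \<le> p A" "\<And>i. i \<in> J \<Longrightarrow> (\<Sum>A\<in>Pow J. y A i) = d i"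
    by auto
  have "\<exists>q :: 'a option pmf. set_pmf q \<subseteq> insert None (Some ` (J - A)) \<and>
      (A \<subseteq> J \<longrightarrow> (\<forall>i\<in>J. p A * pmf q (Some i) = y A i))" for A
  proof (cases "A \<subseteq> J")
    case True
    have "(\<Sum>i\<in>J. y A i / p A) \<le> 1"
      using y(3)[OF True] p[OF True]
      by (cases "p A = 0") (auto simp: sum_divide_distrib[symmetric] divide_le_eq_1)
    moreover have "0 \<le> y A i / p A" if "i \<in> J" for i
      using y(1)[OF True that] p[OF True] by simp
    ultimately obtain q :: "'a option pmf" where q: "\<And>i. i \<in> J \<Longrightarrow> pmf q (Some i) = y A i / p A"
      "set_pmf q \<subseteq> insert None (Some ` {i\<in>J. y A i / p A \<noteq> 0})"
      using pmf_option_with_weights[OF J, of "\<lambda>i. y A i / p A"] by blast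
    \<comment> \<open>If \<open>p A = 0\<close>, the quotient loses \<open>y A i\<close>; but then
      the nonnegative masses \<open>y A i\<close> sum to at most \<open>0\<close>, so each of them
      vanishes.\<close>
    have "p A * (y A i / p A) = y A i" if i: "i \<in> J" for i
    proof (cases "p A = 0")
      case True
      then have "sum (y A) J = 0"
        using y(1,3)[OF \<open>A \<subseteq> J\<close>] by (simp add: order_antisym sum_nonneg)
      then have "y A i = 0"
        using y(1)[OF \<open>A \<subseteq> J\<close>] J i by (simp add: sum_nonneg_eq_0_iff)
      then show ?thesis by simp
    qed simp
    moreover have "{i\<in>J. y A i / p A \<noteq> 0} \<subseteq> J - A" using y(2)[OF True] by auto
    then have "set_pmf q \<subseteq> insert None (Some ` (J - A))" using q(2) by blast
    ultimately show ?thesis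
      using q(1) by (intro exI[of _ q]) simp
  \<comment> \<open>For \<open>A\<close> not contained in \<open>J\<close> only the support is
    constrained, so idling serves.\<close>
  qed (auto intro!: exI[of _ "return_pmf None"])
  then obtain q :: "'a set \<Rightarrow> 'a option pmf"
    where q: "\<And>A. set_pmf (q A) \<subseteq> insert None (Some ` (J - A))"
      "\<And>A i. A \<subseteq> J \<Longrightarrow> i \<in> J \<Longrightarrow> p A * pmf (q A) (Some i) = y A i"
    by metis
  show thesis
    using q y(4) by (intro that[of q]) auto
qed

section \<open>Runs of rules that ignore the revealed outcomes\<close>

text \<open>A run is reduced to the list of its (job, start time) pairs. For policies that ignore the
  revealed outcomes, this makes the law of a run a function of the sizes alone, so that it lives on
  countable spaces.\<close>

definition busy :: "(nat \<Rightarrow> nat) \<Rightarrow> (nat \<times> nat) list \<Rightarrow> nat \<Rightarrow> bool" where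
  "busy \<sigma> h t \<longleftrightarrow> (\<exists>(i, u) \<in> set h. t < u + \<sigma> i)"

definition plan_step ::
  "(nat \<Rightarrow> nat set \<Rightarrow> nat option pmf) \<Rightarrow> (nat \<Rightarrow> nat) \<Rightarrow> nat \<Rightarrow> (nat \<times> nat) list \<Rightarrow> (nat \<times> nat) list pmf" where
  "plan_step f \<sigma> t h =
     (if busy \<sigma> h t then return_pmf h
      else map_pmf (\<lambda>a. case a of None \<Rightarrow> h | Some i \<Rightarrow> h @ [(i, t)]) (f t (fst ` set h)))"

primrec plan_run ::
  "(nat \<Rightarrow> nat set \<Rightarrow> nat option pmf) \<Rightarrow> (nat \<Rightarrow> nat) \<Rightarrow> nat \<Rightarrow> (nat \<times> nat) list pmf" where
  "plan_run f \<sigma> 0 = return_pmf []"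
| "plan_run f \<sigma> (Suc t) = bind_pmf (plan_run f \<sigma> t) (plan_step f \<sigma> (Suc t))"

text \<open>The support is constrained at all times and for all sets, reachable or not, because
  admissibility ranges over arbitrary histories.\<close>

definition selection_rule :: "nat \<Rightarrow> (nat \<Rightarrow> nat set \<Rightarrow> nat option pmf) \<Rightarrow> bool" where
  "selection_rule n f \<longleftrightarrow> (\<forall>t A. set_pmf (f t A) \<subseteq> insert None (Some ` ({1..n} - A)))"

lemma set_pmf_plan_step:
  "h' \<in> set_pmf (plan_step f \<sigma> t h) \<Longrightarrow>
     h' = h \<or> (\<exists>i. Some i \<in> set_pmf (f t (fst ` set h)) \<and> h' = h @ [(i, t)])"
  by (auto simp: plan_step_def split: if_splits option.splits)

lemma set_pmf_plan_run:
  assumes f: "selection_rule n f" and "h \<in> set_pmf (plan_run f \<sigma> t)"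
  shows "set h \<subseteq> {1..n} \<times> {1..t} \<and> distinct (map fst h)"
  using assms(2)
proof (induction t arbitrary: h)
  case (Suc t)
  then obtain g where g: "g \<in> set_pmf (plan_run f \<sigma> t)" "h \<in> set_pmf (plan_step f \<sigma> (Suc t) g)"
    by auto
  have IH: "set g \<subseteq> {1..n} \<times> {1..t}" "distinct (map fst g)" using Suc.IH[OF g(1)] by auto
  have "{1..n} \<times> {1..t} \<subseteq> {1..n} \<times> {1..Suc t}" by auto
  with IH have sub: "set g \<subseteq> {1..n} \<times> {1..Suc t}" by blast
  from set_pmf_plan_step[OF g(2)] show ?case
  proof
    assume "\<exists>i. Some i \<in> set_pmf (f (Suc t) (fst ` set g)) \<and> h = g @ [(i, Suc t)]"
    then obtain i where i: "Some i \<in> set_pmf (f (Suc t) (fst ` set g))" "h = g @ [(i, Suc t)]"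
      by blast
    then have "i \<in> {1..n} - fst ` set g" using f unfolding selection_rule_def by blast
    then show ?thesis using IH sub i(2) by simp
  qed (use IH sub in simp)
qed simp

text \<open>A run up to \<open>t\<close> consults the rule only at times \<open>1\<close> to
  \<open>t\<close>; this allows the rule to be redefined at a later time without disturbing the
  past.\<close>

lemma plan_run_cong_rule:
  "(\<And>u. 1 \<le> u \<Longrightarrow> u \<le> t \<Longrightarrow> f u = f' u) \<Longrightarrow> plan_run f \<sigma> t = plan_run f' \<sigma> t"
proof (induction t)
  case (Suc t)
  have "plan_step f \<sigma> (Suc t) = plan_step f' \<sigma> (Suc t)"
    using Suc.prems[of "Suc t"] by (simp add: plan_step_def fun_eq_iff)
  then show ?case using Suc by simp
qed simp

text \<open>Under such a rule the outcomes affect the course of the run only through the test for a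
  job in progress, which reads the sizes of started jobs. These lie in \<open>{1..n}\<close>, so
  agreement of \<open>\<sigma>\<close> there suffices; rewards are mere labels.\<close>

lemma run_eq_plan_run:
  assumes f: "selection_rule n f" and \<sigma>: "\<And>i. i \<in> {1..n} \<Longrightarrow> \<sigma> i = fst (\<zeta> i)"
  shows "run (\<lambda>t h. f t (fst ` set h)) \<zeta> t = map_pmf (map (\<lambda>(i, u). (i, u, \<zeta> i))) (plan_run f \<sigma> t)"
proof (induction t)
  case (Suc t)
  let ?m = "map (\<lambda>(i, u). (i, u, \<zeta> i)) :: (nat \<times> nat) list \<Rightarrow> history"
  let ?\<pi> = "\<lambda>t (h :: history). f t (fst ` set h)"
  have "step ?\<pi> \<zeta> (Suc t) (?m h) = map_pmf ?m (plan_step f \<sigma> (Suc t) h)"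
    if h: "h \<in> set_pmf (plan_run f \<sigma> t)" for h
  proof -
    have sub: "set h \<subseteq> {1..n} \<times> {1..t}" using set_pmf_plan_run[OF f h] by simp
    have "in_progress (?m h) (Suc t) = (\<exists>p\<in>set h. Suc t < snd p + fst (\<zeta> (fst p)))"
      by (force simp: in_progress_def case_prod_beta)
    also have "\<dots> = busy \<sigma> h (Suc t)"
      unfolding busy_def using sub \<sigma> by (intro bex_cong) auto
    finally have b: "in_progress (?m h) (Suc t) = busy \<sigma> h (Suc t)" .
    have j: "fst ` set (?m h) = fst ` set h" by (force simp: image_iff)
    show ?thesis
      unfolding step_def plan_step_def b j
      by (auto simp: pmf.map_comp o_def intro!: map_pmf_cong split: option.split)
  qed
  then show ?case
    by (auto simp: Suc.IH bind_map_pmf map_bind_pmf intro!: bind_pmf_cong)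
qed simp

text \<open>The outcome of job \<open>j\<close> influences the run only after \<open>j\<close> has been started.\<close>

lemma plan_run_independent_of_unstarted:
  assumes \<sigma>: "\<And>i. i \<noteq> j \<Longrightarrow> \<sigma> i = \<sigma>' i" and g: "\<And>h. j \<in> fst ` set h \<Longrightarrow> g h = 0"
  shows "(\<integral>\<^sup>+ h. g h \<partial>plan_run f \<sigma> t) = (\<integral>\<^sup>+ h. g h \<partial>plan_run f \<sigma>' t)"
  using g
proof (induction t arbitrary: g)
  case (Suc t)
  \<comment> \<open>A started job stays in the list, so \<open>g\<close> vanishes on every
    continuation.\<close>
  have started: "(\<integral>\<^sup>+ h'. g h' \<partial>plan_step f \<tau> (Suc t) h) = 0" if "j \<in> fst ` set h" for h \<tau>
  proof -
    have "AE h' in plan_step f \<tau> (Suc t) h. g h' = 0"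
      using that by (auto simp: AE_measure_pmf_iff dest!: set_pmf_plan_step intro!: Suc.prems)
    then show ?thesis by (subst nn_integral_0_iff_AE) auto
  qed
  have "plan_step f \<sigma> (Suc t) h = plan_step f \<sigma>' (Suc t) h" if "j \<notin> fst ` set h" for h
  proof -
    have "busy \<sigma> h (Suc t) = busy \<sigma>' h (Suc t)"
      unfolding busy_def using that \<sigma> by (intro bex_cong) (auto simp: image_iff)
    then show ?thesis by (simp add: plan_step_def)
  qed
  then have "(\<integral>\<^sup>+ h'. g h' \<partial>plan_step f \<sigma> (Suc t) h) = (\<integral>\<^sup>+ h'. g h' \<partial>plan_step f \<sigma>' (Suc t) h)" for h
    using started by (cases "j \<in> fst ` set h") auto
  \<comment> \<open>The induction hypothesis is applied to the expectation of \<open>g\<close> one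
    step ahead, which again vanishes on histories containing \<open>j\<close>.\<close>
  then show ?case
    using Suc.IH[of "\<lambda>h. \<integral>\<^sup>+ h'. g h' \<partial>plan_step f \<sigma>' (Suc t) h"] started by simp
qed simp

section \<open>Starting probabilities for fixed sizes\<close>

definition started_prob ::
  "(nat \<Rightarrow> nat set \<Rightarrow> nat option pmf) \<Rightarrow> (nat \<Rightarrow> nat) \<Rightarrow> nat \<Rightarrow> nat \<Rightarrow> nat \<Rightarrow> ennreal" where
  "started_prob f \<sigma> t i u = (\<integral>\<^sup>+ h. indicator {h. (i, u) \<in> set h} h \<partial>plan_run f \<sigma> t)"

text \<open>Entries are never removed, and those added after time \<open>u\<close> carry a later
  start time, so the event is settled at time \<open>u\<close>.\<close>

lemma started_prob_later:
  assumes "u \<le> t" shows "started_prob f \<sigma> t i u = started_prob f \<sigma> u i u"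
  using assms
proof (induction t rule: dec_induct)
  case (step t)
  have "(\<integral>\<^sup>+ h'. indicator {h. (i, u) \<in> set h} h' \<partial>plan_step f \<sigma> (Suc t) h) =
      (indicator {h. (i, u) \<in> set h} h :: ennreal)" for h
  proof -
    have "(\<integral>\<^sup>+ h'. indicator {h. (i, u) \<in> set h} h' \<partial>plan_step f \<sigma> (Suc t) h) =
        (\<integral>\<^sup>+ h'. indicator {h. (i, u) \<in> set h} h \<partial>plan_step f \<sigma> (Suc t) h)"
      using step.hyps
      by (intro nn_integral_cong_AE) (auto simp: AE_measure_pmf_iff indicator_def dest!: set_pmf_plan_step)
    then show ?thesis by simp
  qed
  then show ?case using step.IH by (simp add: started_prob_def)
qed simp

text \<open>All entries made up to \<open>t\<close> have start times at most \<open>t\<close>, so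
  the pair \<open>(i, Suc t)\<close> can only arise from the action chosen now.\<close>

lemma started_prob_now:
  assumes f: "selection_rule n f"
  shows "started_prob f \<sigma> (Suc t) i (Suc t) =
    (\<integral>\<^sup>+ h. (if busy \<sigma> h (Suc t) then 0 else ennreal (pmf (f (Suc t) (fst ` set h)) (Some i)))
      \<partial>plan_run f \<sigma> t)"
proof -
  have "(\<integral>\<^sup>+ h'. indicator {h. (i, Suc t) \<in> set h} h' \<partial>plan_step f \<sigma> (Suc t) h) =
      (if busy \<sigma> h (Suc t) then 0 else ennreal (pmf (f (Suc t) (fst ` set h)) (Some i)))"
    if "h \<in> set_pmf (plan_run f \<sigma> t)" for h
  proof -
    have new: "(i, Suc t) \<notin> set h" using set_pmf_plan_run[OF f that] by auto
    have "indicator {h. (i, Suc t) \<in> set h} (case a of None \<Rightarrow> h | Some i \<Rightarrow> h @ [(i, Suc t)]) =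
      (indicator {Some i} a :: ennreal)" for a
      using new by (auto simp: indicator_def split: option.split)
    then have "(\<integral>\<^sup>+ a. indicator {h. (i, Suc t) \<in> set h} (case a of None \<Rightarrow> h | Some i \<Rightarrow> h @ [(i, Suc t)])
        \<partial>f (Suc t) (fst ` set h)) = ennreal (pmf (f (Suc t) (fst ` set h)) (Some i))"
      by (simp add: emeasure_pmf_single)
    then show ?thesis
      using new by (simp add: plan_step_def emeasure_pmf_single del: nn_integral_indicator)
  qed
  then show ?thesis
    unfolding started_prob_def plan_run.simps nn_integral_bind_pmf
    by (intro nn_integral_cong_AE) (simp add: AE_measure_pmf_iff)
qed

text \<open>The size of \<open>j\<close> can matter only through histories that contain
  \<open>j\<close>, and from those the rule never starts \<open>j\<close> again.\<close>

lemma started_prob_independent: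
  assumes f: "selection_rule n f" and u: "1 \<le> u" "u \<le> t" and \<sigma>: "\<And>i. i \<noteq> j \<Longrightarrow> \<sigma> i = \<sigma>' i"
  shows "started_prob f \<sigma> t j u = started_prob f \<sigma>' t j u"
proof -
  obtain v where v: "u = Suc v" using u by (cases u) auto
  \<comment> \<open>\<open>G\<close> is the conditional probability of starting \<open>j\<close> at
    \<open>u\<close>, given the earlier history. It vanishes once \<open>j\<close> is started, as
    the preceding independence of unstarted jobs requires.\<close>
  define G where "G \<tau> h = (if busy \<tau> h u then 0 else ennreal (pmf (f u (fst ` set h)) (Some j)))" for \<tau> h
  have zero: "G \<tau> h = 0" if "j \<in> fst ` set h" for \<tau> h
  proof -
    have "Some j \<notin> set_pmf (f u (fst ` set h))"
      using f that unfolding selection_rule_def by blast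
    then show ?thesis by (simp add: G_def set_pmf_iff)
  qed
  have "G \<sigma> h = G \<sigma>' h" for h
  proof (cases "j \<in> fst ` set h")
    case False
    then have "busy \<sigma> h u = busy \<sigma>' h u"
      unfolding busy_def using \<sigma> by (intro bex_cong) (auto simp: image_iff)
    then show ?thesis by (simp add: G_def)
  qed (simp add: zero)
  then have "G \<sigma> = G \<sigma>'" by auto
  then have "(\<integral>\<^sup>+ h. G \<sigma> h \<partial>plan_run f \<sigma> v) = (\<integral>\<^sup>+ h. G \<sigma>' h \<partial>plan_run f \<sigma>' v)"
    using plan_run_independent_of_unstarted[of j \<sigma> \<sigma>' "G \<sigma>'"] \<sigma> zero by simp
  then show ?thesis
    using started_prob_later[OF u(2)] started_prob_now[OF f] unfolding v G_def by simp
qed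

section \<open>Averaging over the outcomes: measurability and independence\<close>

context correlated_knapsack
begin

definition sizes :: "'w \<Rightarrow> nat \<Rightarrow> nat" where
  "sizes \<omega> = restrict (\<lambda>i. S i \<omega>) {1..n}"

lemma measurable_job:
  assumes "i \<in> {1..n}"
  shows "(\<lambda>\<omega>. (S i \<omega>, R i \<omega>)) \<in> M \<rightarrow>\<^sub>M count_space UNIV \<Otimes>\<^sub>M borel"
  using jobs_indep assms by (auto simp: indep_vars_def)

lemma measurable_size: "i \<in> {1..n} \<Longrightarrow> S i \<in> M \<rightarrow>\<^sub>M count_space UNIV"
  using measurable_compose[OF measurable_job measurable_fst] by simp

lemma measurable_reward: "i \<in> {1..n} \<Longrightarrow> R i \<in> borel_measurable M"
  using measurable_compose[OF measurable_job measurable_snd] by simp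

text \<open>Restricted to \<open>{1..n}\<close>, the sizes form a random element of a finite product
  of countable discrete spaces, on which every function is measurable.\<close>

lemma measurable_of_sizes: "(\<lambda>\<omega>. H (sizes \<omega>)) \<in> borel_measurable M"
proof -
  have "sizes \<in> M \<rightarrow>\<^sub>M PiM {1..n} (\<lambda>_. count_space UNIV)"
    unfolding sizes_def using measurable_size by (intro measurable_restrict) auto
  then show ?thesis
    by (rule measurable_compose) (simp add: count_space_PiM_finite)
qed

text \<open>Independent jobs split into the independent blocks \<open>{j}\<close> and the rest, and
  expectations of nonnegative functions of independent blocks multiply. Discreteness of the sizes
  allows an arbitrary \<open>H\<close>.\<close>

lemma nn_integral_independent_job:
  fixes H :: "(nat \<Rightarrow> nat) \<Rightarrow> ennreal"
  assumes j: "j \<in> {1..n}" and g: "g \<in> borel_measurable (count_space UNIV \<Otimes>\<^sub>M borel)"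
  shows "(\<integral>\<^sup>+ \<omega>. H (restrict (\<lambda>i. S i \<omega>) ({1..n} - {j})) * g (S j \<omega>, R j \<omega>) \<partial>M) =
    (\<integral>\<^sup>+ \<omega>. H (restrict (\<lambda>i. S i \<omega>) ({1..n} - {j})) \<partial>M) * (\<integral>\<^sup>+ \<omega>. g (S j \<omega>, R j \<omega>) \<partial>M)"
proof -
  let ?K = "{1..n} - {j}" and ?N = "\<lambda>_::nat. count_space UNIV \<Otimes>\<^sub>M borel :: (nat \<times> real) measure"
  let ?X = "\<lambda>A \<omega>. restrict (\<lambda>i. (S i \<omega>, R i \<omega>)) A"
  let ?Y1 = "\<lambda>z. H (restrict (\<lambda>i. fst (z i)) ?K)" and ?Y2 = "\<lambda>z. g (z j)"
  have "(\<lambda>z. restrict (\<lambda>i. fst (z i)) ?K) \<in> PiM ?K ?N \<rightarrow>\<^sub>M PiM ?K (\<lambda>_. count_space UNIV)"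
    by (rule measurable_restrict) measurable
  then have Y1: "?Y1 \<in> borel_measurable (PiM ?K ?N)"
    by (rule measurable_compose) (simp add: count_space_PiM_finite)
  have Y2: "?Y2 \<in> borel_measurable (PiM {j} ?N)"
    by (rule measurable_compose[OF measurable_component_singleton[of j "{j}" ?N]]) (auto intro: g)
  have "indep_var borel (?Y1 \<circ> ?X ?K) borel (?Y2 \<circ> ?X {j})"
    using j by (intro indep_var_compose[OF indep_var_restrict[OF jobs_indep] Y1 Y2]) auto
  \<comment> \<open>The two blocks become a family indexed by the booleans, to which the product
    rule for nonnegative integrals applies.\<close>
  then have "indep_vars (\<lambda>_. borel) (case_bool (?Y1 \<circ> ?X ?K) (?Y2 \<circ> ?X {j})) UNIV"
    by (simp add: indep_var_def bool.case_distrib[symmetric] case_bool_if)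
  from indep_vars_nn_integral[OF _ this]
  have "(\<integral>\<^sup>+ \<omega>. ?Y1 (?X ?K \<omega>) * ?Y2 (?X {j} \<omega>) \<partial>M) =
      (\<integral>\<^sup>+ \<omega>. ?Y1 (?X ?K \<omega>) \<partial>M) * (\<integral>\<^sup>+ \<omega>. ?Y2 (?X {j} \<omega>) \<partial>M)"
    by (simp add: UNIV_bool comp_def mult.commute)
  moreover have "?Y1 (?X ?K \<omega>) = H (restrict (\<lambda>i. S i \<omega>) ?K)" for \<omega>
    by (rule arg_cong[where f=H]) auto
  ultimately show ?thesis by simp
qed

text \<open>The size of \<open>j\<close> can be erased from the size vector without changing the
  probability of starting \<open>j\<close>, which is then independent of the outcome of
  \<open>j\<close>. Below, \<open>g\<close> is a tail indicator of the size in the union bound and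
  the collected reward in the objective.\<close>

lemma nn_integral_started_times_job:
  assumes f: "selection_rule n f" and u: "1 \<le> u" "u \<le> t"
    and j: "j \<in> {1..n}" and g: "g \<in> borel_measurable (count_space UNIV \<Otimes>\<^sub>M borel)"
  shows "(\<integral>\<^sup>+ \<omega>. started_prob f (sizes \<omega>) t j u * g (S j \<omega>, R j \<omega>) \<partial>M) =
    (\<integral>\<^sup>+ \<omega>. started_prob f (sizes \<omega>) t j u \<partial>M) * (\<integral>\<^sup>+ \<omega>. g (S j \<omega>, R j \<omega>) \<partial>M)"
proof -
  have "started_prob f (sizes \<omega>) t j u =
      started_prob f (restrict (\<lambda>i. S i \<omega>) ({1..n} - {j})) t j u" for \<omega>
    by (intro started_prob_independent[OF f u]) (auto simp: sizes_def)
  then show ?thesis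
    using nn_integral_independent_job[OF j g, of "\<lambda>\<sigma>. started_prob f \<sigma> t j u"] by simp
qed

section \<open>The probability mass available at a time step\<close>

text \<open>This is the supply for the decision at time \<open>Suc t\<close>: the decisions up to
  \<open>t\<close> have been made, and the machine is free at the next step.\<close>

definition idle_prob :: "(nat \<Rightarrow> nat set \<Rightarrow> nat option pmf) \<Rightarrow> nat \<Rightarrow> nat set \<Rightarrow> ennreal" where
  "idle_prob f t A = (\<integral>\<^sup>+ \<omega>. (\<integral>\<^sup>+ h. indicator {h. \<not> busy (sizes \<omega>) h (Suc t) \<and> fst ` set h = A} h
     \<partial>plan_run f (sizes \<omega>) t) \<partial>M)"

lemma idle_prob_finite: "idle_prob f t A < top"
proof -
  have "(\<integral>\<^sup>+ h. indicator {h. \<not> busy (sizes \<omega>) h (Suc t) \<and> fst ` set h = A} h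
     \<partial>plan_run f (sizes \<omega>) t) \<le> 1" for \<omega>
    by (simp add: measure_pmf.emeasure_le_1)
  then have "idle_prob f t A \<le> (\<integral>\<^sup>+ \<omega>. 1 \<partial>M)"
    unfolding idle_prob_def by (intro nn_integral_mono) auto
  also have "\<dots> < top" by (simp add: emeasure_space_1)
  finally show ?thesis .
qed

text \<open>Free histories are grouped by their set of started jobs, since the law of the next
  action depends on nothing else.\<close>

lemma started_prob_eq_sum_idle:
  assumes f: "selection_rule n f"
  shows "(\<integral>\<^sup>+ \<omega>. started_prob f (sizes \<omega>) (Suc t) i (Suc t) \<partial>M) =
    (\<Sum>A\<in>Pow {1..n}. idle_prob f t A * ennreal (pmf (f (Suc t) A) (Some i)))"
proof -
  let ?I = "\<lambda>\<sigma> A. indicator {h. \<not> busy \<sigma> h (Suc t) \<and> fst ` set h = A}"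
  have "started_prob f \<sigma> (Suc t) i (Suc t) =
    (\<Sum>A\<in>Pow {1..n}. (\<integral>\<^sup>+ h. ?I \<sigma> A h \<partial>plan_run f \<sigma> t) * ennreal (pmf (f (Suc t) A) (Some i)))" for \<sigma>
  proof -
    have "started_prob f \<sigma> (Suc t) i (Suc t) =
      (\<integral>\<^sup>+ h. (\<Sum>A\<in>Pow {1..n}. ?I \<sigma> A h * ennreal (pmf (f (Suc t) A) (Some i))) \<partial>plan_run f \<sigma> t)"
      unfolding started_prob_now[OF f]
    proof (intro nn_integral_cong_AE, unfold AE_measure_pmf_iff, intro ballI)
      fix h assume "h \<in> set_pmf (plan_run f \<sigma> t)"
      then have sub: "fst ` set h \<subseteq> {1..n}" using set_pmf_plan_run[OF f] by fastforce
      have "(\<Sum>A\<in>Pow {1..n}. ?I \<sigma> A h * ennreal (pmf (f (Suc t) A) (Some i))) =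
        (\<Sum>A\<in>Pow {1..n}. if fst ` set h = A then
           (if busy \<sigma> h (Suc t) then 0 else ennreal (pmf (f (Suc t) A) (Some i))) else 0)"
        by (intro sum.cong) (auto simp: indicator_def)
      also have "\<dots> = (if busy \<sigma> h (Suc t) then 0
          else ennreal (pmf (f (Suc t) (fst ` set h)) (Some i)))"
        using sub by (subst sum.delta') auto
      finally show "(if busy \<sigma> h (Suc t) then 0
          else ennreal (pmf (f (Suc t) (fst ` set h)) (Some i))) =
        (\<Sum>A\<in>Pow {1..n}. ?I \<sigma> A h * ennreal (pmf (f (Suc t) A) (Some i)))" ..
    qed
    also have "\<dots> = (\<Sum>A\<in>Pow {1..n}.
        (\<integral>\<^sup>+ h. ?I \<sigma> A h \<partial>plan_run f \<sigma> t) * ennreal (pmf (f (Suc t) A) (Some i)))"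
      by (subst nn_integral_sum) (auto simp del: nn_integral_indicator simp: nn_integral_multc)
    finally show ?thesis .
  qed
  then have "(\<integral>\<^sup>+ \<omega>. started_prob f (sizes \<omega>) (Suc t) i (Suc t) \<partial>M) =
    (\<Sum>A\<in>Pow {1..n}. \<integral>\<^sup>+ \<omega>. (\<integral>\<^sup>+ h. ?I (sizes \<omega>) A h \<partial>plan_run f (sizes \<omega>) t) *
       ennreal (pmf (f (Suc t) A) (Some i)) \<partial>M)"
    by (simp only:) (intro nn_integral_sum measurable_of_sizes)
  also have "\<dots> = (\<Sum>A\<in>Pow {1..n}. idle_prob f t A * ennreal (pmf (f (Suc t) A) (Some i)))"
    unfolding idle_prob_def
    by (intro sum.cong refl nn_integral_multc measurable_of_sizes)
  finally show ?thesis .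
qed

lemma remaining_eq:
  assumes lp: "lp_feasible M n B S x s" and i: "i \<in> {1..n}" and "Suc t \<le> B"
  shows "s i (Suc t) = 1 - (\<Sum>u=1..t. x i u)"
  using \<open>Suc t \<le> B\<close>
proof (induction t)
  case 0
  then show ?case using lp i by (simp add: lp_feasible_def)
next
  case (Suc t)
  have "s i (Suc (Suc t)) = s i (Suc (Suc t) - 1) - x i (Suc (Suc t) - 1)"
    using lp i Suc.prems by (simp add: lp_feasible_def)
  then show ?case using Suc by simp
qed

lemma nn_integral_size_gt:
  assumes "j \<in> {1..n}"
  shows "(\<integral>\<^sup>+ \<omega>. indicator {k. m < k} (S j \<omega>) \<partial>M) = ennreal (measure M {\<omega> \<in> space M. S j \<omega> > m})"
proof -
  have "{\<omega> \<in> space M. S j \<omega> > m} \<in> sets M"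
    using measurable_sets[OF measurable_size[OF assms], of "{k. m < k}"]
    by (simp add: vimage_def Int_def conj_commute)
  moreover have "(\<integral>\<^sup>+ \<omega>. indicator {k. m < k} (S j \<omega>) \<partial>M) =
      (\<integral>\<^sup>+ \<omega>. indicator {\<omega> \<in> space M. S j \<omega> > m} \<omega> \<partial>M)"
    by (intro nn_integral_cong) (auto simp: indicator_def)
  ultimately show ?thesis by (simp add: emeasure_eq_measure)
qed

text \<open>In every history, some started job still runs, or \<open>i\<close> has been started, or
  the machine is free and the started set avoids \<open>i\<close>. So at least one indicator is
  \<open>1\<close>; this is shown for fixed sizes and then averaged.\<close>

lemma idle_union_bound:
  assumes f: "selection_rule n f" and i: "i \<in> {1..n}"
  shows "1 \<le> (\<Sum>A\<in>{A\<in>Pow {1..n}. i \<notin> A}. idle_prob f t A) +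
    (\<Sum>j=1..n. \<Sum>u=1..t. (\<integral>\<^sup>+ \<omega>. started_prob f (sizes \<omega>) t j u \<partial>M) *
        ennreal (measure M {\<omega> \<in> space M. S j \<omega> > Suc t - u})) +
    (\<Sum>u=1..t. \<integral>\<^sup>+ \<omega>. started_prob f (sizes \<omega>) t i u \<partial>M)"
proof -
  let ?P = "{A\<in>Pow {1..n}. i \<notin> A}"
  let ?I = "\<lambda>\<sigma> A. indicator {h. \<not> busy \<sigma> h (Suc t) \<and> fst ` set h = A} :: _ \<Rightarrow> ennreal"
  let ?L = "\<lambda>\<sigma> j u. indicator {k. Suc t - u < k} (\<sigma> j :: nat) :: ennreal"
  have pw: "1 \<le> (\<Sum>A\<in>?P. \<integral>\<^sup>+ h. ?I \<sigma> A h \<partial>plan_run f \<sigma> t) +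
    (\<Sum>j=1..n. \<Sum>u=1..t. started_prob f \<sigma> t j u * ?L \<sigma> j u) +
    (\<Sum>u=1..t. started_prob f \<sigma> t i u)" for \<sigma>
  proof -
    let ?E = "\<lambda>j u. indicator {h. (j, u) \<in> set h} :: _ \<Rightarrow> ennreal"
    have meas: "g \<in> borel_measurable (measure_pmf p)" for g :: "(nat \<times> nat) list \<Rightarrow> ennreal" and p
      by simp
    have "1 = (\<integral>\<^sup>+ h. 1 \<partial>plan_run f \<sigma> t)"
      by simp
    also have "\<dots> \<le> (\<integral>\<^sup>+ h. (\<Sum>A\<in>?P. ?I \<sigma> A h) + (\<Sum>j=1..n. \<Sum>u=1..t. ?E j u h * ?L \<sigma> j u) +
      (\<Sum>u=1..t. ?E i u h) \<partial>plan_run f \<sigma> t)"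
    proof (intro nn_integral_mono_AE, unfold AE_measure_pmf_iff, intro ballI)
      fix h assume "h \<in> set_pmf (plan_run f \<sigma> t)"
      then have sub: "set h \<subseteq> {1..n} \<times> {1..t}" using set_pmf_plan_run[OF f] by blast
      consider "busy \<sigma> h (Suc t)" | "i \<in> fst ` set h" | "\<not> busy \<sigma> h (Suc t)" "i \<notin> fst ` set h"
        by blast
      then show "1 \<le> (\<Sum>A\<in>?P. ?I \<sigma> A h) + (\<Sum>j=1..n. \<Sum>u=1..t. ?E j u h * ?L \<sigma> j u) +
        (\<Sum>u=1..t. ?E i u h)"
      proof cases
        case 1
        then obtain j u where ju: "(j, u) \<in> set h" "Suc t < u + \<sigma> j" by (auto simp: busy_def)
        then have mem: "j \<in> {1..n}" "u \<in> {1..t}" using sub by auto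
        \<comment> \<open>Since \<open>u \<le> t\<close>, the subtraction in
          \<open>Suc t - u\<close> is not truncated, and the tail event says exactly that
          \<open>j\<close> still occupies time \<open>Suc t\<close>.\<close>
        have "1 = ?E j u h * ?L \<sigma> j u" using ju mem by (simp add: indicator_def less_diff_conv2)
        also have "\<dots> \<le> (\<Sum>u=1..t. ?E j u h * ?L \<sigma> j u)"
          using mem by (intro member_le_sum) auto
        also have "\<dots> \<le> (\<Sum>j=1..n. \<Sum>u=1..t. ?E j u h * ?L \<sigma> j u)"
          using mem by (intro member_le_sum[of j "{1..n}" "\<lambda>j. \<Sum>u=1..t. ?E j u h * ?L \<sigma> j u"]) auto
        finally show ?thesis by (simp add: add_increasing add_increasing2)
      next
        case 2
        then obtain u where u: "(i, u) \<in> set h" by auto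
        then have "u \<in> {1..t}" using sub by auto
        then have "?E i u h \<le> (\<Sum>u=1..t. ?E i u h)"
          by (intro member_le_sum) auto
        then show ?thesis using u by (simp add: add_increasing)
      next
        case 3
        then have "fst ` set h \<in> ?P" using sub by fastforce
        then have "?I \<sigma> (fst ` set h) h \<le> (\<Sum>A\<in>?P. ?I \<sigma> A h)"
          by (intro member_le_sum) auto
        then show ?thesis using 3 by (simp add: add_increasing2)
      qed
    qed
    also have "\<dots> = (\<Sum>A\<in>?P. \<integral>\<^sup>+ h. ?I \<sigma> A h \<partial>plan_run f \<sigma> t) +
        (\<Sum>j=1..n. \<Sum>u=1..t. started_prob f \<sigma> t j u * ?L \<sigma> j u) +
        (\<Sum>u=1..t. started_prob f \<sigma> t i u)"
      by (simp only: nn_integral_add nn_integral_sum nn_integral_multc started_prob_def meas)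
    finally show ?thesis .
  qed
  note meas = measurable_of_sizes
  have sz: "?L (sizes \<omega>) j u = ?L (\<lambda>j. S j \<omega>) j u" if "j \<in> {1..n}" for j u \<omega>
    using that by (simp add: sizes_def)
  have "1 = (\<integral>\<^sup>+ \<omega>. 1 \<partial>M)" by (simp add: emeasure_space_1)
  also have "\<dots> \<le> (\<integral>\<^sup>+ \<omega>. (\<Sum>A\<in>?P. \<integral>\<^sup>+ h. ?I (sizes \<omega>) A h \<partial>plan_run f (sizes \<omega>) t) +
    (\<Sum>j=1..n. \<Sum>u=1..t. started_prob f (sizes \<omega>) t j u * ?L (sizes \<omega>) j u) +
    (\<Sum>u=1..t. started_prob f (sizes \<omega>) t i u) \<partial>M)"
    by (intro nn_integral_mono pw)
  also have "\<dots> = (\<integral>\<^sup>+ \<omega>. (\<Sum>A\<in>?P. \<integral>\<^sup>+ h. ?I (sizes \<omega>) A h \<partial>plan_run f (sizes \<omega>) t) +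
    (\<Sum>j=1..n. \<Sum>u=1..t. started_prob f (sizes \<omega>) t j u * ?L (sizes \<omega>) j u) \<partial>M) +
    (\<integral>\<^sup>+ \<omega>. (\<Sum>u=1..t. started_prob f (sizes \<omega>) t i u) \<partial>M)"
    by (intro nn_integral_add meas)
  also have "(\<integral>\<^sup>+ \<omega>. (\<Sum>A\<in>?P. \<integral>\<^sup>+ h. ?I (sizes \<omega>) A h \<partial>plan_run f (sizes \<omega>) t) +
      (\<Sum>j=1..n. \<Sum>u=1..t. started_prob f (sizes \<omega>) t j u * ?L (sizes \<omega>) j u) \<partial>M) =
    (\<integral>\<^sup>+ \<omega>. (\<Sum>A\<in>?P. \<integral>\<^sup>+ h. ?I (sizes \<omega>) A h \<partial>plan_run f (sizes \<omega>) t) \<partial>M) +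
    (\<integral>\<^sup>+ \<omega>. (\<Sum>j=1..n. \<Sum>u=1..t. started_prob f (sizes \<omega>) t j u * ?L (sizes \<omega>) j u) \<partial>M)"
    by (intro nn_integral_add meas)
  also have "(\<integral>\<^sup>+ \<omega>. (\<Sum>A\<in>?P. \<integral>\<^sup>+ h. ?I (sizes \<omega>) A h \<partial>plan_run f (sizes \<omega>) t) \<partial>M) =
      (\<Sum>A\<in>?P. idle_prob f t A)"
    unfolding idle_prob_def by (intro nn_integral_sum meas)
  also have "(\<integral>\<^sup>+ \<omega>. (\<Sum>u=1..t. started_prob f (sizes \<omega>) t i u) \<partial>M) =
      (\<Sum>u=1..t. \<integral>\<^sup>+ \<omega>. started_prob f (sizes \<omega>) t i u \<partial>M)"
    by (intro nn_integral_sum meas)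
  also have "(\<integral>\<^sup>+ \<omega>. (\<Sum>j=1..n. \<Sum>u=1..t. started_prob f (sizes \<omega>) t j u * ?L (sizes \<omega>) j u) \<partial>M) =
      (\<Sum>j=1..n. \<integral>\<^sup>+ \<omega>. (\<Sum>u=1..t. started_prob f (sizes \<omega>) t j u * ?L (sizes \<omega>) j u) \<partial>M)"
    by (intro nn_integral_sum meas)
  also have "\<dots> = (\<Sum>j=1..n. \<Sum>u=1..t. \<integral>\<^sup>+ \<omega>. started_prob f (sizes \<omega>) t j u * ?L (sizes \<omega>) j u \<partial>M)"
    by (intro sum.cong refl nn_integral_sum meas)
  also have "\<dots> = (\<Sum>j=1..n. \<Sum>u=1..t. (\<integral>\<^sup>+ \<omega>. started_prob f (sizes \<omega>) t j u \<partial>M) *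
      ennreal (measure M {\<omega> \<in> space M. S j \<omega> > Suc t - u}))"
  proof (intro sum.cong refl)
    fix j u assume ju: "j \<in> {1..n}" "u \<in> {1..t}"
    have "(\<lambda>z::nat \<times> real. indicator {k. Suc t - u < k} (fst z) :: ennreal)
        \<in> borel_measurable (count_space UNIV \<Otimes>\<^sub>M borel)"
      by (rule measurable_compose[OF measurable_fst]) simp
    \<comment> \<open>The start of \<open>j\<close> is independent of its size, so the joint
      probability factors into the product that appears in the linear program.\<close>
    from nn_integral_started_times_job[OF f _ _ ju(1) this, of u t] ju
    show "(\<integral>\<^sup>+ \<omega>. started_prob f (sizes \<omega>) t j u * ?L (sizes \<omega>) j u \<partial>M) =
      (\<integral>\<^sup>+ \<omega>. started_prob f (sizes \<omega>) t j u \<partial>M) *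
      ennreal (measure M {\<omega> \<in> space M. S j \<omega> > Suc t - u})"
      by (simp add: sz nn_integral_size_gt)
  qed
  finally show ?thesis .
qed

text \<open>With starting probabilities scaled by one half, running jobs and an earlier start of
  \<open>i\<close> each account for at most one half in the union bound; the packing constraint
  moreover reserves the current demand out of the first half.\<close>

lemma idle_capacity:
  assumes lp: "lp_feasible M n B S x s" and f: "selection_rule n f" and t: "Suc t \<le> B"
    and started: "\<And>j u. j \<in> {1..n} \<Longrightarrow> u \<in> {1..t} \<Longrightarrow>
      (\<integral>\<^sup>+ \<omega>. started_prob f (sizes \<omega>) t j u \<partial>M) = ennreal (x j u / 2)"
    and i: "i \<in> {1..n}"
  shows "(\<Sum>j=1..n. x j (Suc t) / 2) \<le> (\<Sum>A\<in>{A\<in>Pow {1..n}. i \<notin> A}. enn2real (idle_prob f t A))"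
proof -
  let ?P = "{A\<in>Pow {1..n}. i \<notin> A}"
  let ?q = "\<lambda>j u. measure M {\<omega> \<in> space M. S j \<omega> > Suc t - u}"
  have x0: "0 \<le> x j u" if "j \<in> {1..n}" "u \<in> {1..B}" for j u
    using lp that by (auto simp: lp_feasible_def)
  have x0t: "0 \<le> x j u" if "j \<in> {1..n}" "u \<in> {1..t}" for j u
    using x0[of j u] that t by simp
  \<comment> \<open>Finiteness allows passing to the reals, where the bounds can be
    subtracted.\<close>
  have idle: "idle_prob f t A = ennreal (enn2real (idle_prob f t A))" for A
    using idle_prob_finite[of f t A] by simp
  have e1: "(\<Sum>j=1..n. \<Sum>u=1..t. (\<integral>\<^sup>+ \<omega>. started_prob f (sizes \<omega>) t j u \<partial>M) * ennreal (?q j u)) =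
      ennreal (\<Sum>j=1..n. \<Sum>u=1..t. x j u / 2 * ?q j u)"
  proof -
    have nn: "0 \<le> x j u / 2 * ?q j u" if "j \<in> {1..n}" "u \<in> {1..t}" for j u
      using x0t[OF that] by simp
    have "(\<Sum>u=1..t. (\<integral>\<^sup>+ \<omega>. started_prob f (sizes \<omega>) t j u \<partial>M) * ennreal (?q j u)) =
        ennreal (\<Sum>u=1..t. x j u / 2 * ?q j u)" if j: "j \<in> {1..n}" for j
    proof -
      have "(\<Sum>u=1..t. (\<integral>\<^sup>+ \<omega>. started_prob f (sizes \<omega>) t j u \<partial>M) * ennreal (?q j u)) =
          (\<Sum>u=1..t. ennreal (x j u / 2 * ?q j u))"
        by (intro sum.cong refl, subst ennreal_mult) (use started x0t j in auto)
      also have "\<dots> = ennreal (\<Sum>u=1..t. x j u / 2 * ?q j u)"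
        by (intro sum_ennreal nn j)
      finally show ?thesis .
    qed
    then have "(\<Sum>j=1..n. \<Sum>u=1..t. (\<integral>\<^sup>+ \<omega>. started_prob f (sizes \<omega>) t j u \<partial>M) * ennreal (?q j u)) =
        (\<Sum>j=1..n. ennreal (\<Sum>u=1..t. x j u / 2 * ?q j u))"
      by (intro sum.cong refl)
    also have "\<dots> = ennreal (\<Sum>j=1..n. \<Sum>u=1..t. x j u / 2 * ?q j u)"
      by (intro sum_ennreal sum_nonneg nn)
    finally show ?thesis .
  qed
  have e2: "(\<Sum>u=1..t. \<integral>\<^sup>+ \<omega>. started_prob f (sizes \<omega>) t i u \<partial>M) = ennreal (\<Sum>u=1..t. x i u / 2)"
  proof -
    have "(\<Sum>u=1..t. \<integral>\<^sup>+ \<omega>. started_prob f (sizes \<omega>) t i u \<partial>M) = (\<Sum>u=1..t. ennreal (x i u / 2))"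
      by (intro sum.cong refl started i)
    also have "\<dots> = ennreal (\<Sum>u=1..t. x i u / 2)"
      using x0t[OF i] by (intro sum_ennreal) simp
    finally show ?thesis .
  qed
  have e3: "(\<Sum>A\<in>?P. idle_prob f t A) = ennreal (\<Sum>A\<in>?P. enn2real (idle_prob f t A))"
    by (subst idle) simp
  have nn: "0 \<le> (\<Sum>A\<in>?P. enn2real (idle_prob f t A))" "0 \<le> (\<Sum>j=1..n. \<Sum>u=1..t. x j u / 2 * ?q j u)"
      "0 \<le> (\<Sum>u=1..t. x i u / 2)"
    using x0t i by (auto intro!: sum_nonneg)
  have "ennreal 1 \<le> ennreal ((\<Sum>A\<in>?P. enn2real (idle_prob f t A)) +
     (\<Sum>j=1..n. \<Sum>u=1..t. x j u / 2 * ?q j u) + (\<Sum>u=1..t. x i u / 2))"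
    using idle_union_bound[OF f i, of t] unfolding e1 e2 e3
    by (subst ennreal_plus, (use nn in simp)+)
  then have *: "1 \<le> (\<Sum>A\<in>?P. enn2real (idle_prob f t A)) +
     (\<Sum>j=1..n. \<Sum>u=1..t. x j u / 2 * ?q j u) + (\<Sum>u=1..t. x i u / 2)"
    using nn by (subst (asm) ennreal_le_iff) (auto intro!: add_nonneg_nonneg)
  \<comment> \<open>Sizes are positive, so the summand of the current time has tail probability
    \<open>1\<close> and contributes the whole demand to the constraint.\<close>
  have q1: "?q j (Suc t) = 1" if "j \<in> {1..n}" for j
    using size_pos[OF that] prob_space by (simp cong: conj_cong)
  have "1 \<ge> (\<Sum>j=1..n. \<Sum>u=1..Suc t. x j u * ?q j u)"
    using lp t by (simp add: lp_feasible_def del: sum.cl_ivl_Suc)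
  also have "(\<Sum>j=1..n. \<Sum>u=1..Suc t. x j u * ?q j u) =
      2 * (\<Sum>j=1..n. \<Sum>u=1..t. x j u / 2 * ?q j u) + 2 * (\<Sum>j=1..n. x j (Suc t) / 2)"
    using q1 by (simp add: sum.distrib sum_distrib_left)
  finally have **: "2 * (\<Sum>j=1..n. \<Sum>u=1..t. x j u / 2 * ?q j u) + 2 * (\<Sum>j=1..n. x j (Suc t) / 2) \<le> 1" .
  \<comment> \<open>These two bounds make \<open>s i (Suc t)\<close> nonnegative, so the earlier
    values \<open>x i u\<close> sum to at most \<open>1\<close>.\<close>
  have "0 \<le> x i (Suc t)" "x i (Suc t) \<le> s i (Suc t)"
    using lp i t by (auto simp: lp_feasible_def)
  then have "2 * (\<Sum>u=1..t. x i u / 2) \<le> 1"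
    using remaining_eq[OF lp i t] by (simp add: sum_distrib_left)
  with * ** show ?thesis by linarith
qed

section \<open>Constructing the rule one time step at a time\<close>

text \<open>The rule up to \<open>t\<close> determines the supplies at \<open>Suc t\<close>, and the
  capacity bound lets the greedy assignment meet the demands \<open>x i (Suc t) / 2\<close> from
  them.\<close>

lemma selection_rule_exists:
  assumes lp: "lp_feasible M n B S x s" and "t \<le> B"
  shows "\<exists>f. selection_rule n f \<and> (\<forall>i\<in>{1..n}. \<forall>u\<in>{1..t}.
    (\<integral>\<^sup>+ \<omega>. started_prob f (sizes \<omega>) t i u \<partial>M) = ennreal (x i u / 2))"
  using \<open>t \<le> B\<close>
proof (induction t)
  case 0
  show ?case by (intro exI[of _ "\<lambda>_ _. return_pmf None"]) (simp add: selection_rule_def)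
next
  case (Suc t)
  then obtain f where f: "selection_rule n f"
    and IH: "\<And>i u. i \<in> {1..n} \<Longrightarrow> u \<in> {1..t} \<Longrightarrow>
      (\<integral>\<^sup>+ \<omega>. started_prob f (sizes \<omega>) t i u \<partial>M) = ennreal (x i u / 2)"
    by auto
  have x0: "0 \<le> x i (Suc t)" if "i \<in> {1..n}" for i
    using lp that Suc.prems by (auto simp: lp_feasible_def)
  obtain q where q: "\<And>A. set_pmf (q A) \<subseteq> insert None (Some ` ({1..n} - A))"
    "\<And>i. i \<in> {1..n} \<Longrightarrow>
      (\<Sum>A\<in>Pow {1..n}. enn2real (idle_prob f t A) * pmf (q A) (Some i)) = x i (Suc t) / 2"
  proof (rule greedy_assignment[of "{1..n}" "\<lambda>A. enn2real (idle_prob f t A)" "\<lambda>i. x i (Suc t) / 2"])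
    show "(\<Sum>j=1..n. x j (Suc t) / 2) \<le> (\<Sum>A\<in>{A\<in>Pow {1..n}. i \<notin> A}. enn2real (idle_prob f t A))"
      if "i \<in> {1..n}" for i
      by (rule idle_capacity[OF lp f Suc.prems IH that])
  qed (use x0 in auto)
  \<comment> \<open>Only the decision at \<open>Suc t\<close> is replaced, so runs up to
    \<open>t\<close>, and with them the supplies used to choose \<open>q\<close>, stay the
    same.\<close>
  define f' where "f' = f(Suc t := q)"
  have f': "selection_rule n f'" using f q(1) by (simp add: selection_rule_def f'_def)
  have run: "plan_run f' \<sigma> t = plan_run f \<sigma> t" for \<sigma>
    by (rule plan_run_cong_rule) (simp add: f'_def)
  have idle: "idle_prob f' t A = ennreal (enn2real (idle_prob f t A))" for A
    using idle_prob_finite[of f t A] by (simp add: idle_prob_def run)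
  have "(\<integral>\<^sup>+ \<omega>. started_prob f' (sizes \<omega>) (Suc t) i u \<partial>M) = ennreal (x i u / 2)"
    if i: "i \<in> {1..n}" and u: "u \<in> {1..Suc t}" for i u
  proof (cases "u = Suc t")
    case True
    have "(\<integral>\<^sup>+ \<omega>. started_prob f' (sizes \<omega>) (Suc t) i (Suc t) \<partial>M) =
        (\<Sum>A\<in>Pow {1..n}. ennreal (enn2real (idle_prob f t A) * pmf (q A) (Some i)))"
      unfolding started_prob_eq_sum_idle[OF f'] idle by (simp add: f'_def ennreal_mult)
    also have "\<dots> = ennreal (x i (Suc t) / 2)"
      by (subst sum_ennreal, simp) (simp only: q(2)[OF i])
    finally show ?thesis using True by simp
  next
    case False
    then have u': "u \<le> t" "u \<in> {1..t}" using u by auto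
    have "started_prob f' \<sigma> (Suc t) i u = started_prob f \<sigma> t i u" for \<sigma>
      using started_prob_later[of u "Suc t" f'] started_prob_later[of u t f'] u'(1)
      by (simp add: started_prob_def run)
    then show ?thesis using IH[OF i u'(2)] by simp
  qed
  with f' show ?case by blast
qed

section \<open>Rewards and the objective\<close>

text \<open>The probability cancels the denominator; on a null event both sides are
  \<open>0\<close>.\<close>

lemma cond_reward_times_prob:
  assumes i: "i \<in> {1..n}"
  shows "cond_reward M S R i k * emeasure M {\<omega> \<in> space M. S i \<omega> = k} =
    (\<integral>\<^sup>+ \<omega>. ennreal (R i \<omega>) * indicator {\<omega>. S i \<omega> = k} \<omega> \<partial>M)"
proof (cases "emeasure M {\<omega> \<in> space M. S i \<omega> = k} = 0")
  case True
  have "{\<omega> \<in> space M. S i \<omega> = k} \<in> sets M"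
    using measurable_sets[OF measurable_size[OF i], of "{k}"]
    by (simp add: vimage_def Int_def conj_commute)
  then have "AE \<omega> in M. S i \<omega> \<noteq> k"
    using True by (subst AE_iff_measurable) auto
  then have "(\<integral>\<^sup>+ \<omega>. ennreal (R i \<omega>) * indicator {\<omega>. S i \<omega> = k} \<omega> \<partial>M) = (\<integral>\<^sup>+ \<omega>. 0 \<partial>M)"
    by (intro nn_integral_cong_AE) auto
  then show ?thesis using True by simp
next
  case False
  then show ?thesis
    by (simp add: cond_reward_def ennreal_divide_times emeasure_eq_measure)
qed

text \<open>The index \<open>t'\<close> is the first time step after completion,
  \<open>t + S i \<omega>\<close>; the upper limit \<open>B + 1\<close> therefore means completion
  by the end of \<open>B\<close>.\<close>

lemma nn_integral_reward_eq_ER: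
  assumes i: "i \<in> {1..n}"
  shows "(\<integral>\<^sup>+ \<omega>. (if t + S i \<omega> - 1 \<le> B then ennreal (R i \<omega>) else 0) \<partial>M) = ER M B S R i t"
proof -
  have [measurable]: "S i \<in> M \<rightarrow>\<^sub>M count_space UNIV" "R i \<in> borel_measurable M"
    using measurable_size[OF i] measurable_reward[OF i] by auto
  have "ER M B S R i t = (\<Sum>t'=t+1..B+1. \<integral>\<^sup>+ \<omega>. (if S i \<omega> = t' - t then ennreal (R i \<omega>) else 0) \<partial>M)"
    unfolding ER_def cond_reward_times_prob[OF i]
    by (intro sum.cong refl nn_integral_cong) (simp add: indicator_def)
  also have "\<dots> = (\<integral>\<^sup>+ \<omega>. (\<Sum>t'=t+1..B+1. if S i \<omega> = t' - t then ennreal (R i \<omega>) else 0) \<partial>M)"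
    by (rule nn_integral_sum[symmetric]) measurable
  also have "\<dots> = (\<integral>\<^sup>+ \<omega>. (if t + S i \<omega> - 1 \<le> B then ennreal (R i \<omega>) else 0) \<partial>M)"
  proof (rule nn_integral_cong)
    fix \<omega> assume "\<omega> \<in> space M"
    then have pos: "0 < S i \<omega>" by (rule size_pos[OF i])
    have "(\<Sum>t'=t+1..B+1. if S i \<omega> = t' - t then ennreal (R i \<omega>) else 0) =
        (\<Sum>t'=t+1..B+1. if t + S i \<omega> = t' then ennreal (R i \<omega>) else 0)"
      by (intro sum.cong refl if_cong) auto
    \<comment> \<open>Positivity puts \<open>t + S i \<omega>\<close> at or above the lower limit
      \<open>t + 1\<close>, so exactly one summand survives when the job completes in time.\<close>
    also have "\<dots> = (if t + S i \<omega> - 1 \<le> B then ennreal (R i \<omega>) else 0)"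
      using pos by (subst sum.delta') auto
    finally show "(\<Sum>t'=t+1..B+1. if S i \<omega> = t' - t then ennreal (R i \<omega>) else 0) =
      (if t + S i \<omega> - 1 \<le> B then ennreal (R i \<omega>) else 0)" .
  qed
  finally show ?thesis ..
qed

abbreviation rule_policy :: "(nat \<Rightarrow> nat set \<Rightarrow> nat option pmf) \<Rightarrow> policy" where
  "rule_policy f \<equiv> \<lambda>t h. f t (fst ` set h)"

text \<open>The set of started jobs does not change with the outcomes attached to a list, so the
  action probabilities are constant in \<open>\<zeta>\<close> and hence measurable.\<close>

lemma admissible_rule_policy:
  assumes "selection_rule n f"
  shows "admissible_policy n B (rule_policy f)"
proof -
  have "fst ` set (map (\<lambda>(i, u). (i, u, \<zeta> i)) js) = fst ` set js"
    for \<zeta> :: "nat \<Rightarrow> nat \<times> real" and js :: "(nat \<times> nat) list"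
    by (force simp: image_iff)
  then show ?thesis
    using assms unfolding admissible_policy_def selection_rule_def by simp
qed

lemma policy_expectation_rule_policy:
  assumes "selection_rule n f"
  shows "policy_expectation M B S R (rule_policy f) F =
    (\<integral>\<^sup>+ \<omega>. (\<integral>\<^sup>+ h. F (map (\<lambda>(i, u). (i, u, S i \<omega>, R i \<omega>)) h) \<partial>plan_run f (sizes \<omega>) B) \<partial>M)"
proof -
  have "run (rule_policy f) (\<lambda>i. (S i \<omega>, R i \<omega>)) B =
      map_pmf (map (\<lambda>(i, u). (i, u, S i \<omega>, R i \<omega>))) (plan_run f (sizes \<omega>) B)" for \<omega>
    by (rule run_eq_plan_run[OF assms]) (simp add: sizes_def)
  then show ?thesis by (simp add: policy_expectation_def)
qed

lemma start_prob_rule_policy: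
  assumes "selection_rule n f"
  shows "start_prob M B S R (rule_policy f) i t = (\<integral>\<^sup>+ \<omega>. started_prob f (sizes \<omega>) B i t \<partial>M)"
proof -
  have "indicator {h. starts_at h i t} (map (\<lambda>(i, u). (i, u, S i \<omega>, R i \<omega>)) h) =
      (indicator {h. (i, t) \<in> set h} h :: ennreal)" for \<omega> h
    by (force simp: starts_at_def indicator_def image_iff)
  then show ?thesis
    by (simp only: start_prob_def policy_expectation_rule_policy[OF assms] started_prob_def)
qed

text \<open>The collected reward is a sum over all pairs of job and time of a start indicator times
  the reward gained from that start. Linearity and independence of each start from the job's own
  outcome do the rest.\<close>

lemma expected_reward_rule_policy:
  assumes f: "selection_rule n f"
  shows "expected_reward M B S R (rule_policy f) =
    (\<Sum>i=1..n. \<Sum>t=1..B. (\<integral>\<^sup>+ \<omega>. started_prob f (sizes \<omega>) B i t \<partial>M) * ER M B S R i t)"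
proof -
  let ?g = "\<lambda>t (s :: nat, r). if t + s - 1 \<le> B then ennreal r else 0"
  let ?E = "\<lambda>i t. indicator {h. (i, t) \<in> set h} :: _ \<Rightarrow> ennreal"
  have g: "?g t \<in> borel_measurable (count_space UNIV \<Otimes>\<^sub>M borel)" for t :: nat
    by measurable
  have gm: "(\<lambda>\<omega>. ?g t (S i \<omega>, R i \<omega>)) \<in> borel_measurable M" if "i \<in> {1..n}" for i t
    by (rule measurable_compose[OF measurable_job[OF that] g])
  have inner: "(\<integral>\<^sup>+ h. collected_reward B (map (\<lambda>(i, u). (i, u, \<zeta> i)) h) \<partial>plan_run f \<sigma> B) =
      (\<Sum>i=1..n. \<Sum>t=1..B. started_prob f \<sigma> B i t * ?g t (\<zeta> i))" for \<sigma> \<zeta>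
  proof -
    have meas: "G \<in> borel_measurable (measure_pmf p)" for G :: "(nat \<times> nat) list \<Rightarrow> ennreal" and p
      by simp
    have "(\<integral>\<^sup>+ h. collected_reward B (map (\<lambda>(i, u). (i, u, \<zeta> i)) h) \<partial>plan_run f \<sigma> B) =
        (\<integral>\<^sup>+ h. (\<Sum>i=1..n. \<Sum>t=1..B. ?E i t h * ?g t (\<zeta> i)) \<partial>plan_run f \<sigma> B)"
    proof (intro nn_integral_cong_AE, unfold AE_measure_pmf_iff, intro ballI)
      fix h assume "h \<in> set_pmf (plan_run f \<sigma> B)"
      \<comment> \<open>No job is started twice, so the list has no repetitions and its sum becomes
        a sum over a set.\<close>
      then have h: "set h \<subseteq> {1..n} \<times> {1..B}" "distinct h"
        using set_pmf_plan_run[OF f] distinct_map by blast+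
      have "collected_reward B (map (\<lambda>(i, u). (i, u, \<zeta> i)) h) = (\<Sum>(i, t)\<leftarrow>h. ?g t (\<zeta> i))"
        unfolding collected_reward_def map_map
        by (intro arg_cong[where f=sum_list] map_cong refl) (auto split: prod.split)
      also have "\<dots> = (\<Sum>(i, t)\<in>set h. ?g t (\<zeta> i))"
        using h(2) by (rule sum_list_distinct_conv_sum_set)
      also have "\<dots> = (\<Sum>(i, t)\<in>{1..n} \<times> {1..B}. ?E i t h * ?g t (\<zeta> i))"
        using h(1) by (intro sum.mono_neutral_cong_left) (auto simp: indicator_def)
      finally show "collected_reward B (map (\<lambda>(i, u). (i, u, \<zeta> i)) h) =
          (\<Sum>i=1..n. \<Sum>t=1..B. ?E i t h * ?g t (\<zeta> i))"
        by (simp only: sum.cartesian_product)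
    qed
    also have "\<dots> = (\<Sum>i=1..n. \<Sum>t=1..B. started_prob f \<sigma> B i t * ?g t (\<zeta> i))"
      by (simp only: nn_integral_sum nn_integral_multc started_prob_def meas)
    finally show ?thesis .
  qed
  have "expected_reward M B S R (rule_policy f) =
      (\<integral>\<^sup>+ \<omega>. (\<Sum>i=1..n. \<Sum>t=1..B. started_prob f (sizes \<omega>) B i t * ?g t (S i \<omega>, R i \<omega>)) \<partial>M)"
    unfolding expected_reward_def policy_expectation_rule_policy[OF f]
    by (intro nn_integral_cong inner)
  also have "\<dots> =
      (\<Sum>i=1..n. \<integral>\<^sup>+ \<omega>. (\<Sum>t=1..B. started_prob f (sizes \<omega>) B i t * ?g t (S i \<omega>, R i \<omega>)) \<partial>M)"
    by (intro nn_integral_sum borel_measurable_sum borel_measurable_times_ennreal gm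
        measurable_of_sizes)
  also have "\<dots> =
      (\<Sum>i=1..n. \<Sum>t=1..B. \<integral>\<^sup>+ \<omega>. started_prob f (sizes \<omega>) B i t * ?g t (S i \<omega>, R i \<omega>) \<partial>M)"
    by (intro sum.cong refl nn_integral_sum borel_measurable_times_ennreal gm
        measurable_of_sizes)
  also have "\<dots> = (\<Sum>i=1..n. \<Sum>t=1..B. (\<integral>\<^sup>+ \<omega>. started_prob f (sizes \<omega>) B i t \<partial>M) * ER M B S R i t)"
  proof (intro sum.cong refl)
    fix i t assume it: "i \<in> {1..n}" "t \<in> {1..B}"
    then show "(\<integral>\<^sup>+ \<omega>. started_prob f (sizes \<omega>) B i t * ?g t (S i \<omega>, R i \<omega>) \<partial>M) =
        (\<integral>\<^sup>+ \<omega>. started_prob f (sizes \<omega>) B i t \<partial>M) * ER M B S R i t"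
      using nn_integral_started_times_job[OF f _ _ it(1) g, of t B t]
        nn_integral_reward_eq_ER[OF it(1), of t] by simp
  qed
  finally show ?thesis .
qed

lemma half_policy_exists:
  assumes lp: "lp_feasible M n B S x s"
  shows "\<exists>\<pi>. admissible_policy n B \<pi> \<and>
    (\<forall>i\<in>{1..n}. \<forall>t\<in>{1..B}. start_prob M B S R \<pi> i t = ennreal (x i t / 2)) \<and>
    expected_reward M B S R \<pi> = lp_objective M n B S R x / 2"
proof -
  obtain f where f: "selection_rule n f" and started: "\<And>i t. i \<in> {1..n} \<Longrightarrow> t \<in> {1..B} \<Longrightarrow>
      (\<integral>\<^sup>+ \<omega>. started_prob f (sizes \<omega>) B i t \<partial>M) = ennreal (x i t / 2)"
    using selection_rule_exists[OF lp order_refl] by blast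
  \<comment> \<open>\<open>ER\<close> may be infinite, so the halving is done in the extended
    nonnegative reals, as multiplication by \<open>inverse 2\<close>.\<close>
  have half: "ennreal (x i t / 2) * ER M B S R i t = ER M B S R i t * ennreal (x i t) * inverse 2"
    if "i \<in> {1..n}" "t \<in> {1..B}" for i t
  proof -
    have "ennreal (x i t / 2) = ennreal (x i t) / 2"
      using lp that by (subst divide_ennreal[symmetric]) (auto simp: lp_feasible_def)
    then show ?thesis by (simp add: divide_ennreal_def mult_ac)
  qed
  have "expected_reward M B S R (rule_policy f) =
      (\<Sum>i=1..n. \<Sum>t=1..B. ER M B S R i t * ennreal (x i t) * inverse 2)"
    unfolding expected_reward_rule_policy[OF f]
    by (intro sum.cong refl) (simp only: started half)
  also have "\<dots> = lp_objective M n B S R x / 2"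
    by (simp add: lp_objective_def divide_ennreal_def sum_distrib_right)
  finally show ?thesis
    using admissible_rule_policy[OF f] start_prob_rule_policy[OF f] started
    by (intro exI[of _ "rule_policy f"]) simp
qed

end

section \<open>From feasible points to the projection gap\<close>

theorem theorem4:
  fixes M :: "'w measure" and n B :: nat
    and S :: "nat \<Rightarrow> 'w \<Rightarrow> nat" and R :: "nat \<Rightarrow> 'w \<Rightarrow> real"
  assumes "correlated_knapsack M n B S R"
  shows "(\<forall>x s. lp_feasible M n B S x s \<longrightarrow>
            (\<exists>\<pi>. admissible_policy n B \<pi> \<and>
                 (\<forall>i\<in>{1..n}. \<forall>t\<in>{1..B}. start_prob M B S R \<pi> i t = ennreal (x i t / 2)) \<and>
                 expected_reward M B S R \<pi> = lp_objective M n B S R x / 2)) \<and>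
         lp_opt M n B S R \<le> 2 * max_expected_reward M n B S R"
proof (intro conjI allI impI)
  interpret correlated_knapsack M n B S R by (rule assms)
  fix x s assume lp: "lp_feasible M n B S x s"
  show "\<exists>\<pi>. admissible_policy n B \<pi> \<and>
      (\<forall>i\<in>{1..n}. \<forall>t\<in>{1..B}. start_prob M B S R \<pi> i t = ennreal (x i t / 2)) \<and>
      expected_reward M B S R \<pi> = lp_objective M n B S R x / 2"
    by (rule half_policy_exists[OF lp])
next
  interpret correlated_knapsack M n B S R by (rule assms)
  show "lp_opt M n B S R \<le> 2 * max_expected_reward M n B S R"
    unfolding lp_opt_def
  proof (intro SUP_least, clarify)
    fix x s assume "lp_feasible M n B S x s"
    then obtain \<pi> where \<pi>: "admissible_policy n B \<pi>"
        "expected_reward M B S R \<pi> = lp_objective M n B S R x / 2"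
      using half_policy_exists by blast
    \<comment> \<open>Doubling undoes halving even when the objective is infinite.\<close>
    have "lp_objective M n B S R x = 2 * expected_reward M B S R \<pi>"
      unfolding \<pi>(2) by (simp add: ennreal_times_divide mult.commute[of 2] mult_divide_eq_ennreal)
    also have "\<dots> \<le> 2 * max_expected_reward M n B S R"
      unfolding max_expected_reward_def using \<pi>(1) by (intro mult_left_mono SUP_upper) auto
    finally show "lp_objective M n B S R x \<le> 2 * max_expected_reward M n B S R" .
  qed
qed

end
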